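(* Let $G$ be a finite simple graph on $n$ vertices, where $n$ is even. If there exists a magnetic potential $\alpha$ on $G$ such that $$\lambda_{\frac{n}{2}+1}(\Delta_\alpha^G) < 2,$$ then $G$ is not matchable, i.e. $G$ has no perfect matching.
   Context: For a finite simple graph $G=(V,E)$ let $A$ be its set of arcs: each edge gives two oppositely oriented arcs $e,\bar e$; an arc $e$ has initial vertex $\partial_-e$ and terminal vertex $\partial_+e$; $A_v=\{e\in A : \partial_-e=v\}$ and $\deg(v)=|A_v|$. A magnetic potential on $G$ is a map $\alpha\colon A\to\mathbb{R}/2\pi\mathbb{Z}$ with $\alpha_{\bar e}=-\alpha_e$ for all $e\in A$. The discrete magnetic Laplacian is the operator $\Delta_\alpha^G$ on $\mathbb{C}^{V}$ (with its standard inner product) given by $(\Delta_\alpha^G\varphi)(v)=\deg(v)\varphi(v)-\sum_{e\in A_v}\mathrm{e}^{\mathrm{i}\alpha_e}\varphi(\partial_+e)$; it is self-adjoint and positive semidefinite. Its eigenvalues are written in ascending order, repeated according to multiplicity: $\lambda_1(\Delta_\alpha^G)\le\dots\le\lambda_n(\Delta_\alpha^G)$, $n=|V|$. A matching is a set of edges no two of which share a vertex; it is perfect if every vertex of $G$ is an endpoint of one of its edges; a graph is matchable if it has a perfect matching. *)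

theory Defs
  imports
    "HOL-Library.Function_Algebras"
    "HOL-Library.Real_Mod"
    "Graph_Theory.Pair_Digraph"
begin

text \<open>
  A finite simple graph is a \<^locale>\<open>pair_graph\<close>: a finite, loopfree, symmetric digraph whose arcs
  are pairs of vertices. An undirected edge is a two-element vertex set, and the reverse of an
  arc \<open>e\<close> is \<open>prod.swap e\<close>.
\<close>

definition edges :: "'v pair_pre_digraph \<Rightarrow> 'v set set" where
  "edges G = {{u, v} | u v. (u, v) \<in> parcs G}"

definition matching :: "'v pair_pre_digraph \<Rightarrow> 'v set set \<Rightarrow> bool" where
  "matching G M \<longleftrightarrow> M \<subseteq> edges G \<and> (\<forall>e\<in>M. \<forall>f\<in>M. e \<noteq> f \<longrightarrow> e \<inter> f = {})"

definition perfect_matching :: "'v pair_pre_digraph \<Rightarrow> 'v set set \<Rightarrow> bool" where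
  "perfect_matching G M \<longleftrightarrow> matching G M \<and> (\<forall>v\<in>pverts G. \<exists>e\<in>M. v \<in> e)"

definition matchable :: "'v pair_pre_digraph \<Rightarrow> bool" where
  "matchable G \<longleftrightarrow> (\<exists>M. perfect_matching G M)"

text \<open>
  Elements of \<open>\<real>/2\<pi>\<int>\<close> are given by real representatives, so the antisymmetry condition is a
  congruence modulo \<open>2\<pi>\<close>. Everything below depends on \<open>\<alpha>\<close> only through \<open>cis (\<alpha> e)\<close>, that is,
  only on the classes.
\<close>

definition magnetic_potential :: "'v pair_pre_digraph \<Rightarrow> ('v \<times> 'v \<Rightarrow> real) \<Rightarrow> bool" where
  "magnetic_potential G \<alpha> \<longleftrightarrow>
     (\<forall>e\<in>parcs G. [\<alpha> (prod.swap e) = - \<alpha> e] (rmod (2 * pi)))"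

text \<open>The complex vector space of all functions on the vertex type.\<close>

global_interpretation cfun: vector_space "\<lambda>(c::complex) (\<phi>::'v \<Rightarrow> complex) v. c * \<phi> v"
  by unfold_locales (auto simp: fun_eq_iff algebra_simps)

text \<open>
  \<open>\<complex>\<^sup>V\<close> is realised as its subspace of functions vanishing outside of \<open>V\<close>; correspondingly the
  Laplacian is set to \<open>0\<close> there.
\<close>

definition vertex_functions :: "'v pair_pre_digraph \<Rightarrow> ('v \<Rightarrow> complex) set" where
  "vertex_functions G = {\<phi>. \<forall>v. v \<notin> pverts G \<longrightarrow> \<phi> v = 0}"

definition magnetic_laplacian ::
    "'v pair_pre_digraph \<Rightarrow> ('v \<times> 'v \<Rightarrow> real) \<Rightarrow> ('v \<Rightarrow> complex) \<Rightarrow> 'v \<Rightarrow> complex" where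
  "magnetic_laplacian G \<alpha> \<phi> v =
     (if v \<in> pverts G
      then of_nat (out_degree (with_proj G) v) * \<phi> v
             - (\<Sum>e\<in>out_arcs (with_proj G) v. cis (\<alpha> e) * \<phi> (snd e))
      else 0)"

text \<open>
  As the Laplacian is self-adjoint, it suffices to consider real \<open>\<mu>\<close>, and the multiplicity of an
  eigenvalue is the complex dimension of its eigenspace.
\<close>

definition eigenspace ::
    "'v pair_pre_digraph \<Rightarrow> ('v \<times> 'v \<Rightarrow> real) \<Rightarrow> real \<Rightarrow> ('v \<Rightarrow> complex) set" where
  "eigenspace G \<alpha> \<mu> =
     {\<phi> \<in> vertex_functions G. magnetic_laplacian G \<alpha> \<phi> = (\<lambda>v. of_real \<mu> * \<phi> v)}"

definition eigenvalues :: "'v pair_pre_digraph \<Rightarrow> ('v \<times> 'v \<Rightarrow> real) \<Rightarrow> real set" where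
  "eigenvalues G \<alpha> = {\<mu>. \<exists>\<phi>\<in>eigenspace G \<alpha> \<mu>. \<phi> \<noteq> 0}"

definition eigen_multiplicity :: "'v pair_pre_digraph \<Rightarrow> ('v \<times> 'v \<Rightarrow> real) \<Rightarrow> real \<Rightarrow> nat" where
  "eigen_multiplicity G \<alpha> \<mu> = cfun.dim (eigenspace G \<alpha> \<mu>)"

definition eigenvalue_list :: "'v pair_pre_digraph \<Rightarrow> ('v \<times> 'v \<Rightarrow> real) \<Rightarrow> real list" where
  "eigenvalue_list G \<alpha> =
     concat (map (\<lambda>\<mu>. replicate (eigen_multiplicity G \<alpha> \<mu>) \<mu>)
       (sorted_list_of_set (eigenvalues G \<alpha>)))"

text \<open>
  \<open>eigval G \<alpha> k\<close> is \<open>\<lambda>\<^sub>k\<close>, counted from \<open>k = 1\<close>. It is meaningful only for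
  \<open>1 \<le> k \<le> card (pverts G)\<close>.
\<close>

definition eigval :: "'v pair_pre_digraph \<Rightarrow> ('v \<times> 'v \<Rightarrow> real) \<Rightarrow> nat \<Rightarrow> real" where
  "eigval G \<alpha> k = eigenvalue_list G \<alpha> ! (k - 1)"

end

(*
  Twice the quadratic form of the Laplacian is the sum of |phi(u) - exp(i alpha(u,v)) phi(v)|^2
  over all arcs (u,v). Given a perfect matching, the functions with
  phi(u) = - exp(i alpha(u,v)) phi(v) on its edges form a space of dimension n/2, and already the
  arcs of the matching make the quadratic form at least 2 |phi|^2 there. If the first n/2 + 1
  eigenvalues were less than 2, then the form would be less than 2 |phi|^2 on the nonzero elements
  of a space of dimension greater than n/2, and the two spaces would intersect nontrivially.
  That the list of eigenvalues has n entries at all is the spectral theorem, which is derived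
  from the fundamental theorem of algebra by induction on the degree of an annihilating polynomial.
*)

theory Submission
  imports Defs "HOL-Computational_Algebra.Fundamental_Theorem_Algebra"
begin

section \<open>Independent families of subspaces\<close>

context vector_space
begin

text \<open>In a vanishing combination the terms from one \<open>B i\<close> sum to \<open>x\<close>
  and the remaining ones to \<open>- x\<close>, so \<open>x\<close> lies in both spans and is zero.
  A nonzero coefficient at some \<open>v\<close> in \<open>B i\<close> then contradicts the
  independence of \<open>B i\<close>.\<close>

lemma independent_UN:
  assumes indep: "\<And>i. i \<in> I \<Longrightarrow> independent (B i)"
    and indep_sum: "\<And>i. i \<in> I \<Longrightarrow> span (B i) \<inter> span (\<Union>j\<in>I - {i}. B j) \<subseteq> {0}"
  shows "independent (\<Union>i\<in>I. B i)"
proof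
  assume "dependent (\<Union>i\<in>I. B i)"
  then obtain t u v where t: "finite t" "t \<subseteq> (\<Union>i\<in>I. B i)" "(\<Sum>b\<in>t. u b *s b) = 0"
    and v: "v \<in> t" "u v \<noteq> 0"
    unfolding dependent_explicit by blast
  from t v obtain i where i: "i \<in> I" "v \<in> B i" by blast
  define x where "x = (\<Sum>b\<in>t \<inter> B i. u b *s b)"
  define y where "y = (\<Sum>b\<in>t - B i. u b *s b)"
  have "x + y = 0"
    using sum.Int_Diff[OF t(1), of "\<lambda>b. u b *s b" "B i"] t(3) by (simp add: x_def y_def)
  moreover have x: "x \<in> span (B i)"
    unfolding x_def by (intro span_sum span_scale) (auto intro: span_base)
  moreover have "y \<in> span (\<Union>j\<in>I - {i}. B j)"
    unfolding y_def using t(2) by (intro span_sum span_scale span_base) blast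
  then have "- y \<in> span (\<Union>j\<in>I - {i}. B j)"
    by (rule span_neg)
  ultimately have "x = 0"
    using indep_sum[OF i(1)] by (auto simp: add_eq_0_iff2)
  moreover have "finite (t \<inter> B i)" "t \<inter> B i \<subseteq> B i" "v \<in> t \<inter> B i"
    using t v i by auto
  ultimately have "dependent (B i)"
    unfolding dependent_explicit x_def using v(2) by blast
  with indep[OF i(1)] show False by contradiction
qed

text \<open>A common element would have to be zero, which no independent set contains. This is what
  lets cardinalities of bases be added.\<close>

lemma disjoint_if_span_inter:
  assumes "independent B" "span B \<inter> span C \<subseteq> {0}"
  shows "B \<inter> C = {}"
  using assms span_superset[of B] span_superset[of C] dependent_zero[of B] by blast

lemma independent_Un:
  assumes "independent B" "independent C" "span B \<inter> span C \<subseteq> {0}"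
  shows "independent (B \<union> C)"
proof -
  have "independent (\<Union>i\<in>UNIV. if i then B else C)"
    by (rule independent_UN) (use assms in \<open>auto simp: UNIV_bool split: if_splits\<close>)
  then show ?thesis by (simp add: UNIV_bool Un_commute)
qed

end

section \<open>Sorted lists with multiplicities\<close>

lemma sorted_concat_replicate:
  "sorted xs \<Longrightarrow> sorted (concat (map (\<lambda>x. replicate (m x) x) xs))"
  by (induction xs) (auto simp: sorted_append sorted_replicate)

lemma length_concat_replicate:
  "length (concat (map (\<lambda>x. replicate (m x) x) xs)) = sum_list (map m xs)"
  by (simp add: length_concat comp_def)

lemma filter_concat_replicate:
  "filter P (concat (map (\<lambda>x. replicate (m x) x) xs)) =
     concat (map (\<lambda>x. replicate (m x) x) (filter P xs))"
  by (induction xs) auto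

text \<open>By sortedness all positions \<open>0, ..., k\<close> carry entries below
  \<open>c\<close>, which makes \<open>k + 1\<close> of them since positions start at zero.\<close>

lemma length_filter_less_if_sorted:
  fixes c :: "'a :: linorder"
  assumes "sorted xs" "k < length xs" "xs ! k < c"
  shows "k < length (filter (\<lambda>x. x < c) xs)"
proof -
  have "{..k} \<subseteq> {i. i < length xs \<and> xs ! i < c}"
    using assms by (auto dest: sorted_nth_mono intro: order.strict_trans1)
  from card_mono[OF _ this] show ?thesis
    by (simp add: length_filter_conv_card)
qed

section \<open>Hermitian operators on functions with finite support\<close>

text \<open>Linear in the first argument and conjugate-linear in the second. It sees only values on
  \<open>V\<close>, so for finite \<open>V\<close> it is definite on
  \<open>supp_functions V\<close>, not on all functions.\<close>

definition cip :: "'v set \<Rightarrow> ('v \<Rightarrow> complex) \<Rightarrow> ('v \<Rightarrow> complex) \<Rightarrow> complex" where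
  "cip V \<phi> \<psi> = (\<Sum>v\<in>V. \<phi> v * cnj (\<psi> v))"

definition supp_functions :: "'v set \<Rightarrow> ('v \<Rightarrow> complex) set" where
  "supp_functions V = {\<phi>. \<forall>v. v \<notin> V \<longrightarrow> \<phi> v = 0}"

lemma cip_add_left: "cip V (\<phi> + \<psi>) \<chi> = cip V \<phi> \<chi> + cip V \<psi> \<chi>"
  by (simp add: cip_def sum.distrib distrib_left distrib_right)

lemma cip_add_right: "cip V \<chi> (\<phi> + \<psi>) = cip V \<chi> \<phi> + cip V \<chi> \<psi>"
  by (simp add: cip_def sum.distrib distrib_left distrib_right)

lemma cip_scale_left: "cip V (\<lambda>v. c * \<phi> v) \<psi> = c * cip V \<phi> \<psi>"
  by (simp add: cip_def sum_distrib_left mult.assoc mult.left_commute)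

lemma cip_scale_right: "cip V \<phi> (\<lambda>v. c * \<psi> v) = cnj c * cip V \<phi> \<psi>"
  by (simp add: cip_def sum_distrib_left mult.assoc mult.left_commute)

lemma cip_zero_left [simp]: "cip V 0 \<phi> = 0"
  by (simp add: cip_def)

lemma cip_zero_right [simp]: "cip V \<phi> 0 = 0"
  by (simp add: cip_def)

lemma cip_commute: "cip V \<psi> \<phi> = cnj (cip V \<phi> \<psi>)"
  by (simp add: cip_def mult.commute)

lemma cip_self: "cip V \<phi> \<phi> = of_real (\<Sum>v\<in>V. (cmod (\<phi> v))\<^sup>2)"
  by (simp add: cip_def complex_norm_square del: of_real_power)

lemma cip_self_eq_0:
  assumes "finite V" "\<phi> \<in> supp_functions V" "cip V \<phi> \<phi> = 0"
  shows "\<phi> = 0"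
proof
  fix v
  have "(\<Sum>v\<in>V. (cmod (\<phi> v))\<^sup>2) = 0"
    using assms(3) unfolding cip_self of_real_eq_0_iff .
  then have "\<forall>v\<in>V. (cmod (\<phi> v))\<^sup>2 = 0"
    using assms(1) by (subst (asm) sum_nonneg_eq_0_iff) auto
  then show "\<phi> v = 0 v"
    using assms(2) by (auto simp: supp_functions_def)
qed

section \<open>The dimension of the space of functions supported on a finite set\<close>

lemma subspace_supp_functions: "cfun.subspace (supp_functions V)"
  by (auto simp: cfun.subspace_def supp_functions_def)

lemma sum_fun_apply: "(\<Sum>i\<in>I. f i) x = (\<Sum>i\<in>I. f i x)"
  by (induction I rule: infinite_finite_induct) auto

definition unit_fun :: "'v \<Rightarrow> 'v \<Rightarrow> complex" where
  "unit_fun u v = (if v = u then 1 else 0)"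

lemma supp_functions_eq_span:
  assumes "finite V"
  shows "supp_functions V = cfun.span (unit_fun ` V)"
proof
  show "cfun.span (unit_fun ` V) \<subseteq> supp_functions V"
    by (intro cfun.span_minimal subspace_supp_functions)
      (auto simp: supp_functions_def unit_fun_def)
  show "supp_functions V \<subseteq> cfun.span (unit_fun ` V)"
  proof
    fix \<phi> assume \<phi>: "\<phi> \<in> supp_functions V"
    have "\<phi> = (\<Sum>u\<in>V. (\<lambda>v. \<phi> u * unit_fun u v))"
    proof
      fix v
      show "\<phi> v = (\<Sum>u\<in>V. (\<lambda>v. \<phi> u * unit_fun u v)) v"
        using \<phi> assms by (simp add: sum_fun_apply unit_fun_def supp_functions_def if_distrib
            sum.delta cong: if_cong)
    qed
    also have "\<dots> \<in> cfun.span (unit_fun ` V)"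
      by (intro cfun.span_sum cfun.span_scale cfun.span_base) auto
    finally show "\<phi> \<in> cfun.span (unit_fun ` V)" .
  qed
qed

lemma inj_unit_fun: "inj unit_fun"
  by (auto simp: inj_def unit_fun_def fun_eq_iff split: if_splits)

lemma independent_unit_fun: "cfun.independent (unit_fun ` V)"
proof -
  have "cfun.independent (\<Union>v\<in>V. {unit_fun v})"
  proof (rule cfun.independent_UN)
    fix u assume "u \<in> V"
    show "cfun.independent {unit_fun u}"
      by (auto simp: unit_fun_def fun_eq_iff cfun.dependent_single)
    let ?S = "{\<phi>. \<phi> u = (0 :: complex)}"
    have "cfun.span (\<Union>v\<in>V - {u}. {unit_fun v}) \<subseteq> ?S"
      by (rule cfun.span_minimal) (auto simp: cfun.subspace_def unit_fun_def)
    then show "cfun.span {unit_fun u} \<inter> cfun.span (\<Union>v\<in>V - {u}. {unit_fun v}) \<subseteq> {0}"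
      by (auto simp: cfun.span_singleton unit_fun_def fun_eq_iff)
  qed
  then show ?thesis by (simp add: UNION_singleton_eq_range)
qed

text \<open>Steinitz exchange against the spanning family of unit functions.\<close>

lemma independent_supp_functions:
  assumes "finite V" "cfun.independent B" "B \<subseteq> supp_functions V"
  shows "finite B" "card B \<le> card V"
  using cfun.independent_span_bound[of "unit_fun ` V" B] assms
  by (auto simp: supp_functions_eq_span intro: order_trans[OF _ card_image_le])

lemma card_eq_if_spans_supp_functions:
  assumes "finite V" "cfun.independent B" "cfun.span B = supp_functions V"
  shows "card B = card V"
proof -
  have "finite B" "card B \<le> card V"
    using independent_supp_functions[OF assms(1,2)] assms(3) cfun.span_superset by auto
  moreover have "card (unit_fun ` V) \<le> card B"
    using cfun.independent_span_bound[OF \<open>finite B\<close> independent_unit_fun, of V] assms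
      supp_functions_eq_span[OF assms(1)] cfun.span_superset by metis
  ultimately show ?thesis
    by (simp add: card_image inj_on_subset[OF inj_unit_fun])
qed

section \<open>Hermitian operators and orthogonality of their eigenspaces\<close>

locale hermitian_operator =
  fixes V :: "'v set" and T :: "('v \<Rightarrow> complex) \<Rightarrow> 'v \<Rightarrow> complex"
  assumes finite_V: "finite V"
    and T_add: "T (\<phi> + \<psi>) = T \<phi> + T \<psi>"
    and T_scale: "T (\<lambda>v. c * \<phi> v) = (\<lambda>v. c * T \<phi> v)"
    and T_supp: "T \<phi> \<in> supp_functions V"
    and T_adjoint: "cip V (T \<phi>) \<psi> = cip V \<phi> (T \<psi>)"
begin

text \<open>The parameter is complex because the fundamental theorem of algebra supplies complex
  roots; \<open>eigsp_real\<close> shows afterwards that only real ones matter.\<close>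

definition eigsp :: "complex \<Rightarrow> ('v \<Rightarrow> complex) set" where
  "eigsp z = {\<phi> \<in> supp_functions V. T \<phi> = (\<lambda>v. z * \<phi> v)}"

lemma T_zero [simp]: "T 0 = 0"
  using T_add[of 0 0] by simp

lemma subspace_eigsp: "cfun.subspace (eigsp z)"
  unfolding cfun.subspace_def eigsp_def
  by (auto simp: supp_functions_def T_add T_scale fun_eq_iff distrib_left mult.left_commute)

lemma eigsp_real:
  assumes "\<phi> \<in> eigsp z" "\<phi> \<noteq> 0"
  shows "z \<in> \<real>"
proof -
  have "z * cip V \<phi> \<phi> = cnj z * cip V \<phi> \<phi>"
    using T_adjoint[of \<phi> \<phi>] assms(1) by (simp add: eigsp_def cip_scale_left cip_scale_right)
  moreover have "cip V \<phi> \<phi> \<noteq> 0"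
    using assms cip_self_eq_0[OF finite_V] by (auto simp: eigsp_def)
  ultimately show ?thesis
    by (simp add: Reals_cnj_iff)
qed

lemma eigsp_orthogonal:
  assumes "\<phi> \<in> eigsp z" "\<psi> \<in> eigsp w" "z \<noteq> w"
  shows "cip V \<phi> \<psi> = 0"
proof (cases "\<psi> = 0")
  case False
  have "z * cip V \<phi> \<psi> = cnj w * cip V \<phi> \<psi>"
    using T_adjoint[of \<phi> \<psi>] assms by (simp add: eigsp_def cip_scale_left cip_scale_right)
  moreover have "cnj w = w"
    using eigsp_real[OF assms(2) False] by (simp add: Reals_cnj_iff)
  ultimately show ?thesis using assms(3) by simp
qed simp

text \<open>Orthogonality of single eigenvectors extends by linearity, first in the second argument
  and then in the first.\<close>

lemma span_eigsp_orthogonal: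
  assumes \<phi>: "\<phi> \<in> cfun.span (\<Union>z\<in>Z. eigsp z)" and \<psi>: "\<psi> \<in> cfun.span (\<Union>w\<in>W. eigsp w)"
    and "Z \<inter> W = {}"
  shows "cip V \<phi> \<psi> = 0"
proof -
  have 1: "cip V \<chi> \<psi> = 0" if \<chi>: "\<chi> \<in> (\<Union>z\<in>Z. eigsp z)" for \<chi>
    by (rule cfun.span_induct[OF \<psi>])
      (use \<chi> assms(3) in
        \<open>auto simp: cfun.subspace_def cip_add_right cip_scale_right intro!: eigsp_orthogonal\<close>)
  show ?thesis
    by (rule cfun.span_induct[OF \<phi>])
      (use 1 in \<open>auto simp: cfun.subspace_def cip_add_left cip_scale_left\<close>)
qed

lemma span_eigsp_subset: "cfun.span (\<Union>z\<in>Z. eigsp z) \<subseteq> supp_functions V"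
  by (intro cfun.span_minimal subspace_supp_functions) (auto simp: eigsp_def)

definition shift :: "complex \<Rightarrow> ('v \<Rightarrow> complex) \<Rightarrow> 'v \<Rightarrow> complex" where
  "shift z \<phi> = (\<lambda>v. T \<phi> v - z * \<phi> v)"

lemma shift_zero: "shift z 0 = 0"
  unfolding shift_def T_zero by (simp add: fun_eq_iff)

lemma T_diff: "T (\<phi> - \<psi>) = T \<phi> - T \<psi>"
  using T_add[of "\<phi> - \<psi>" \<psi>] by (simp add: eq_diff_eq)

lemma shift_supp: "\<phi> \<in> supp_functions V \<Longrightarrow> shift z \<phi> \<in> supp_functions V"
  using T_supp[of \<phi>] by (auto simp: shift_def supp_functions_def)

lemma shift_eq_0_iff: "\<phi> \<in> supp_functions V \<Longrightarrow> shift z \<phi> = 0 \<longleftrightarrow> \<phi> \<in> eigsp z"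
  by (auto simp: shift_def eigsp_def fun_eq_iff)

text \<open>A Hermitian operator has no nontrivial Jordan chains.\<close>

lemma shift_in_eigsp:
  assumes "\<phi> \<in> supp_functions V" "shift z \<phi> \<in> eigsp z"
  shows "\<phi> \<in> eigsp z"
proof (rule ccontr)
  assume "\<phi> \<notin> eigsp z"
  define \<psi> where "\<psi> = shift z \<phi>"
  have "\<psi> \<noteq> 0"
    using \<open>\<phi> \<notin> eigsp z\<close> assms(1) by (simp add: \<psi>_def shift_eq_0_iff)
  have \<psi>: "\<psi> \<in> eigsp z"
    using assms(2) by (simp add: \<psi>_def)
  have "cnj z = z"
    using eigsp_real[OF \<psi> \<open>\<psi> \<noteq> 0\<close>] by (simp add: Reals_cnj_iff)
  have "T \<phi> = \<psi> + (\<lambda>v. z * \<phi> v)"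
    by (simp add: \<psi>_def shift_def fun_eq_iff)
  \<comment> \<open>Moving \<open>T\<close> to the right argument turns the same number into
    \<open>z * cip V \<phi> \<psi>\<close>, because \<open>z\<close> is real. Hence the squared norm
    of \<psi> vanishes.\<close>
  then have "cip V \<psi> \<psi> + z * cip V \<phi> \<psi> = cip V (T \<phi>) \<psi>"
    by (simp add: cip_add_left cip_scale_left)
  also have "\<dots> = z * cip V \<phi> \<psi>"
    using \<psi> \<open>cnj z = z\<close> by (simp add: T_adjoint eigsp_def cip_scale_right)
  finally have "\<psi> = 0"
    using cip_self_eq_0[OF finite_V, of \<psi>] \<psi> by (simp add: eigsp_def)
  with \<open>\<psi> \<noteq> 0\<close> show False by contradiction
qed

text \<open>On the sum of the eigenspaces, \<open>T - z\<close> is onto up to a remainder in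
  \<open>eigsp z\<close>: components in the other eigenspaces have preimages there, and the
  component in \<open>eigsp z\<close> is the remainder.\<close>

lemma shift_preimage:
  assumes "\<phi> \<in> cfun.span (\<Union>w. eigsp w)"
  shows "\<exists>\<psi>\<in>cfun.span (\<Union>w. eigsp w). \<phi> - shift z \<psi> \<in> eigsp z"
  using assms
proof (induction rule: cfun.span_induct_alt)
  case base
  show ?case
    using cfun.span_zero cfun.subspace_0[OF subspace_eigsp, of z]
    by (intro bexI[of _ 0]) (simp_all only: shift_zero diff_zero)
next
  case (step c x y)
  then obtain w \<psi> where w: "x \<in> eigsp w" and \<psi>: "\<psi> \<in> cfun.span (\<Union>w. eigsp w)"
    "y - shift z \<psi> \<in> eigsp z" by blast
  show ?case
  proof (cases "w = z")
    case True
    have "((\<lambda>v. c * x v) + y) - shift z \<psi> = (\<lambda>v. c * x v) + (y - shift z \<psi>)"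
      by simp
    also have "\<dots> \<in> eigsp z"
      using \<psi>(2) w True subspace_eigsp[of z] cfun.subspace_add cfun.subspace_scale by blast
    finally show ?thesis
      using \<psi>(1) by blast
  next
    case False
    \<comment> \<open>On \<open>eigsp w\<close> the operator \<open>T - z\<close> is multiplication
      by \<open>w - z\<close>, which can be divided out.\<close>
    define x' where "x' = (\<lambda>v. c / (w - z) * x v)"
    have "shift z (x' + \<psi>) = (\<lambda>v. c * x v) + shift z \<psi>"
    proof
      fix v
      have "T x' v = c / (w - z) * (w * x v)"
        using w unfolding x'_def T_scale by (simp add: eigsp_def)
      moreover have "c / (w - z) * (w * x v) - z * (c / (w - z) * x v) = c / (w - z) * (w - z) * x v"
        by (simp only: left_diff_distrib right_diff_distrib mult_ac)
      ultimately have "T x' v - z * x' v = c * x v"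
        using False by (simp add: x'_def)
      then show "shift z (x' + \<psi>) v = ((\<lambda>v. c * x v) + shift z \<psi>) v"
        by (simp add: shift_def T_add distrib_left)
    qed
    then have "(\<lambda>v. c * x v) + y - shift z (x' + \<psi>) = y - shift z \<psi>"
      by (rule ssubst) (rule add_diff_cancel_left)
    with \<psi>(2) have "(\<lambda>v. c * x v) + y - shift z (x' + \<psi>) \<in> eigsp z"
      by (rule back_subst[of "\<lambda>\<chi>. \<chi> \<in> eigsp z", OF _ sym])
    moreover have "x' + \<psi> \<in> cfun.span (\<Union>w. eigsp w)"
      unfolding x'_def using w \<psi>
      by (intro cfun.span_add cfun.span_scale) (auto intro: cfun.span_base)
    ultimately show ?thesis
      by (rule bexI[of _ "x' + \<psi>"])
  qed
qed

text \<open>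
  Hence no orthogonal complements are needed for the spectral theorem: \<open>\<phi>\<close> differs from a sum of
  eigenvectors by an element of \<open>ker (T - z)\<^sup>2 = ker (T - z)\<close>.
\<close>

lemma shift_in_span_eigsp:
  assumes "\<phi> \<in> supp_functions V" "shift z \<phi> \<in> cfun.span (\<Union>w. eigsp w)"
  shows "\<phi> \<in> cfun.span (\<Union>w. eigsp w)"
proof -
  obtain \<psi> where \<psi>: "\<psi> \<in> cfun.span (\<Union>w. eigsp w)" "shift z \<phi> - shift z \<psi> \<in> eigsp z"
    using shift_preimage[OF assms(2)] by (rule bexE)
  have "shift z (\<phi> - \<psi>) = shift z \<phi> - shift z \<psi>"
    by (rule ext) (simp add: shift_def T_diff right_diff_distrib)
  moreover have "\<phi> - \<psi> \<in> supp_functions V"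
    by (rule cfun.subspace_diff[OF subspace_supp_functions assms(1)])
      (use \<psi>(1) span_eigsp_subset[of UNIV] in blast)
  ultimately have "\<phi> - \<psi> \<in> eigsp z"
    using \<psi>(2) by (metis shift_in_eigsp)
  then have "(\<phi> - \<psi>) + \<psi> \<in> cfun.span (\<Union>w. eigsp w)"
    using \<psi>(1) by (intro cfun.span_add) (blast intro: cfun.span_base)
  then show ?thesis by (simp only: diff_add_cancel)
qed

section \<open>Polynomials in the operator and the spectral theorem\<close>

definition papply :: "complex poly \<Rightarrow> ('v \<Rightarrow> complex) \<Rightarrow> 'v \<Rightarrow> complex" where
  "papply p \<phi> = fold_coeffs (\<lambda>a f. (\<lambda>v. a * \<phi> v) + T f) p 0"

lemma papply_0 [simp]: "papply 0 \<phi> = 0"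
  by (simp add: papply_def)

text \<open>\<open>papply\<close> evaluates \<open>p(T)\<close> at \<phi> by Horner's scheme. Since
  \<open>pCons 0 0\<close> is the zero polynomial and has no coefficients to fold over, that case is
  split off.\<close>

lemma papply_pCons [simp]: "papply (pCons a p) \<phi> = (\<lambda>v. a * \<phi> v) + T (papply p \<phi>)"
proof (cases "p = 0 \<and> a = 0")
  case True
  then have "papply (pCons a p) \<phi> = 0"
    by (simp add: papply_def)
  moreover have "(\<lambda>v. a * \<phi> v) + T (papply p \<phi>) = 0"
    by (rule ext) (simp add: True)
  ultimately show ?thesis by simp
next
  case False
  then have "fold_coeffs f (pCons a p) = f a \<circ> fold_coeffs f p"
    for f :: "complex \<Rightarrow> ('v \<Rightarrow> complex) \<Rightarrow> 'v \<Rightarrow> complex"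
    using fold_coeffs_pCons_not_0_0_eq fold_coeffs_pCons_coeff_not_0_eq by blast
  then show ?thesis unfolding papply_def by (simp only: comp_apply)
qed

lemma papply_add: "papply (p + q) \<phi> = papply p \<phi> + papply q \<phi>"
proof (induction p q rule: poly_induct2)
  case (pCons a p b q)
  have "papply (pCons a p + pCons b q) \<phi> = (\<lambda>v. (a + b) * \<phi> v) + T (papply (p + q) \<phi>)"
    by simp
  also have "\<dots> = papply (pCons a p) \<phi> + papply (pCons b q) \<phi>"
    unfolding pCons.IH T_add by (rule ext) (simp add: T_add distrib_right)
  finally show ?case .
qed simp

lemma papply_smult: "papply (smult c p) \<phi> = (\<lambda>v. c * papply p \<phi> v)"
proof (induction p)
  case (pCons a p)
  have "papply (smult c (pCons a p)) \<phi> = (\<lambda>v. c * a * \<phi> v) + T (papply (smult c p) \<phi>)"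
    by simp
  also have "\<dots> = (\<lambda>v. c * papply (pCons a p) \<phi> v)"
    by (subst pCons.IH, subst T_scale, rule ext) (simp add: distrib_left)
  finally show ?case .
qed simp

lemma papply_sum: "papply (\<Sum>i\<in>I. p i) \<phi> = (\<Sum>i\<in>I. papply (p i) \<phi>)"
  by (induction I rule: infinite_finite_induct) (auto simp: papply_add)

lemma papply_monom: "papply (monom c i) \<phi> = (\<lambda>v. c * (T ^^ i) \<phi> v)"
proof (induction i)
  case 0
  then show ?case by (simp add: monom_0)
next
  case (Suc i)
  have "papply (monom c (Suc i)) \<phi> = T (papply (monom c i) \<phi>)"
    by (simp add: monom_Suc fun_eq_iff)
  also have "\<dots> = (\<lambda>v. c * (T ^^ Suc i) \<phi> v)"
    by (subst Suc.IH, subst T_scale) simp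
  finally show ?case .
qed

lemma papply_shift: "papply p (shift z \<phi>) = shift z (papply p \<phi>)"
proof (induction p)
  case 0
  show ?case by (simp only: papply_0 shift_zero)
next
  case (pCons a p)
  have "shift z (papply (pCons a p) \<phi>) = (\<lambda>v. a * shift z \<phi> v) + shift z (T (papply p \<phi>))"
    unfolding papply_pCons shift_def T_add by (rule ext) (simp add: T_scale algebra_simps)
  also have "shift z (T (papply p \<phi>)) = T (shift z (papply p \<phi>))"
  proof -
    have "shift z \<psi> = T \<psi> - (\<lambda>v. z * \<psi> v)" for \<psi>
      by (simp add: shift_def fun_eq_iff)
    then show ?thesis by (simp add: T_diff T_scale)
  qed
  finally show ?case by (simp add: pCons.IH)
qed

text \<open>A linear factor is moved from the polynomial to the vector, lowering the degree of the
  annihilating polynomial by one.\<close>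

lemma papply_linear_mult: "papply ([:- z, 1:] * q) \<phi> = papply q (shift z \<phi>)"
  unfolding papply_shift
  by (simp add: papply_add papply_smult shift_def fun_eq_iff del: smult_minus_left)

lemma funpow_T_supp: "\<phi> \<in> supp_functions V \<Longrightarrow> (T ^^ i) \<phi> \<in> supp_functions V"
  by (cases i) (auto intro: T_supp)

text \<open>The iterates \<open>(T ^^ i) \<phi>\<close> lie in a finite-dimensional space, so they
  satisfy a linear relation, which is read as a polynomial.\<close>

lemma annihilating_poly:
  assumes "\<phi> \<in> supp_functions V"
  shows "\<exists>p. p \<noteq> 0 \<and> papply p \<phi> = 0"
\<comment> \<open>Dependence is a property of sets and does not notice repeated vectors. A
  repetition is therefore treated separately and gives a difference of two monomials.\<close>
proof (cases "inj (\<lambda>i. (T ^^ i) \<phi>)")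
  case False
  then obtain i j where ij: "i \<noteq> j" "(T ^^ i) \<phi> = (T ^^ j) \<phi>"
    by (auto simp: inj_def)
  have "coeff (monom 1 i + monom (- 1) j :: complex poly) i \<noteq> 0"
    using ij(1) by simp
  then have "monom 1 i + monom (- 1) j \<noteq> (0 :: complex poly)" by (metis coeff_0)
  moreover have "papply (monom 1 i + monom (- 1) j) \<phi> = 0"
    using ij(2) by (simp add: papply_add papply_monom fun_eq_iff)
  ultimately show ?thesis by blast
next
  case True
  have "infinite (range (\<lambda>i. (T ^^ i) \<phi>))"
    using True by (simp add: finite_image_iff)
  then have "cfun.dependent (range (\<lambda>i. (T ^^ i) \<phi>))"
    using independent_supp_functions(1)[OF finite_V] funpow_T_supp[OF assms] by blast
  then obtain t u w where t: "finite t" "t \<subseteq> range (\<lambda>i. (T ^^ i) \<phi>)"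
    "(\<Sum>b\<in>t. (\<lambda>v. u b * b v)) = 0" "w \<in> t" "u w \<noteq> 0"
    unfolding cfun.dependent_explicit by blast
  then obtain I where I: "t = (\<lambda>i. (T ^^ i) \<phi>) ` I" by (meson subset_imageE)
  have inj: "inj_on (\<lambda>i. (T ^^ i) \<phi>) I"
    using True by (rule inj_on_subset) simp
  with t(1) have "finite I" by (simp add: I finite_image_iff)
  \<comment> \<open>The coefficients \<open>u\<close> are indexed by vectors; injectivity carries
    them over to exponents.\<close>
  define p where "p = (\<Sum>i\<in>I. monom (u ((T ^^ i) \<phi>)) i)"
  from t(4) obtain i where i: "i \<in> I" "w = (T ^^ i) \<phi>" by (auto simp: I)
  have "coeff p i = u w"
    using i \<open>finite I\<close> by (simp add: p_def coeff_sum coeff_monom sum.delta)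
  then have "p \<noteq> 0" using t(5) by auto
  moreover have "papply p \<phi> = 0"
    using t(3) by (simp add: p_def papply_sum papply_monom I sum.reindex[OF inj])
  ultimately show ?thesis by blast
qed

text \<open>Induction on the degree, for all vectors at once: with a root \<open>z\<close> split
  off, the quotient annihilates \<open>shift z \<phi>\<close>, which is then a sum of eigenvectors,
  and \<open>shift_in_span_eigsp\<close> brings this back to \<phi>.\<close>

lemma annihilated_in_span:
  assumes "p \<noteq> 0" "papply p \<phi> = 0" "\<phi> \<in> supp_functions V"
  shows "\<phi> \<in> cfun.span (\<Union>z. eigsp z)"
  using assms
proof (induction "degree p" arbitrary: p \<phi>)
  case 0
  then obtain a where "p = [:a:]" "a \<noteq> 0"
    by (metis degree_eq_zeroE pCons_0_0)
  with 0 have "\<phi> = 0" by (auto simp: fun_eq_iff)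
  show ?case unfolding \<open>\<phi> = 0\<close> by (rule cfun.span_zero)
next
  case (Suc n)
  then have "\<not> constant (poly p)"
    by (simp add: constant_degree)
  then obtain z where "poly p z = 0"
    using fundamental_theorem_of_algebra by blast
  then obtain q where q: "p = [:- z, 1:] * q"
    by (auto simp: poly_eq_0_iff_dvd elim: dvdE)
  with Suc.prems(1) have "q \<noteq> 0" by auto
  then have "degree p = Suc (degree q)"
    unfolding q by (subst degree_mult_eq) auto
  with Suc.hyps(2) have "n = degree q" by simp
  moreover have "papply q (shift z \<phi>) = 0"
    using Suc.prems(2) unfolding q papply_linear_mult .
  ultimately have "shift z \<phi> \<in> cfun.span (\<Union>z. eigsp z)"
    using Suc.hyps(1)[of q "shift z \<phi>"] \<open>q \<noteq> 0\<close> shift_supp[OF Suc.prems(3)] by blast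
  with Suc.prems(3) show ?case by (rule shift_in_span_eigsp)
qed

theorem span_eigsp: "cfun.span (\<Union>z. eigsp z) = supp_functions V"
  using annihilating_poly annihilated_in_span span_eigsp_subset[of UNIV] by blast

text \<open>Distinct eigenspaces are orthogonal, so the quadratic form of \<open>T - c\<close>
  splits into one summand per eigenvalue, each negative unless its component is zero.\<close>

lemma rayleigh_less:
  assumes "finite F" "\<And>\<mu>. \<mu> \<in> F \<Longrightarrow> \<mu> < c"
    and "\<phi> \<in> cfun.span (\<Union>\<mu>\<in>F. eigsp (of_real \<mu>))" "\<phi> \<noteq> 0"
  shows "Re (cip V (T \<phi>) \<phi>) < c * Re (cip V \<phi> \<phi>)"
  using assms
proof (induction F arbitrary: \<phi> rule: finite_induct)
  case empty
  then show ?case by simp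
next
  case (insert \<mu> F)
  define W where "W = cfun.span (\<Union>\<nu>\<in>F. eigsp (of_real \<nu>))"
  \<comment> \<open>The quadratic form of \<open>T - c\<close>; the goal is its negativity, and the
    mixed terms in \<open>R (x + y)\<close> vanish below.\<close>
  define R where "R \<psi> = Re (cip V (T \<psi>) \<psi>) - c * Re (cip V \<psi> \<psi>)" for \<psi>
  have "cfun.span (eigsp (of_real \<mu>)) = eigsp (of_real \<mu>)"
    using subspace_eigsp by (rule cfun.span_eq_iff[THEN iffD2])
  moreover have "\<phi> \<in> cfun.span (eigsp (of_real \<mu>) \<union> (\<Union>\<nu>\<in>F. eigsp (of_real \<nu>)))"
    using insert.prems(2) by simp
  ultimately obtain x y where xy: "x \<in> eigsp (of_real \<mu>)" "y \<in> W" "\<phi> = x + y"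
    unfolding cfun.span_Un W_def by blast
  have Tx: "T x = (\<lambda>v. of_real \<mu> * x v)"
    using xy(1) by (simp add: eigsp_def)
  have "cip V x y = 0"
  proof (rule span_eigsp_orthogonal)
    show "x \<in> cfun.span (\<Union>z\<in>{of_real \<mu>}. eigsp z)"
      using xy(1) by (auto intro: cfun.span_base)
    show "y \<in> cfun.span (\<Union>z\<in>of_real ` F. eigsp z)"
      using xy(2) by (simp add: W_def image_image)
    show "{of_real \<mu>} \<inter> of_real ` F = {}"
      using insert.hyps(2) by auto
  qed
  moreover from this have "cip V y x = 0"
    using cip_commute[of V y x] by simp
  moreover have "cip V (T y) x = of_real \<mu> * cip V y x"
    by (simp add: T_adjoint Tx cip_scale_right)
  ultimately have "R \<phi> = R x + R y"
    by (simp add: R_def xy(3) T_add Tx cip_add_left cip_add_right cip_scale_left algebra_simps)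
  moreover have "R x < 0" if "x \<noteq> 0"
  proof -
    have "R x = (\<mu> - c) * (\<Sum>v\<in>V. (cmod (x v))\<^sup>2)"
      by (simp add: R_def Tx cip_scale_left cip_self left_diff_distrib)
    moreover have "(\<Sum>v\<in>V. (cmod (x v))\<^sup>2) \<noteq> 0"
      using cip_self_eq_0[OF finite_V, of x] that xy(1)
      by (auto simp: cip_self eigsp_def simp del: of_real_sum of_real_power)
    then have "(\<Sum>v\<in>V. (cmod (x v))\<^sup>2) > 0"
      by (simp add: order.strict_iff_order sum_nonneg)
    ultimately show ?thesis
      using insert.prems(1)[of \<mu>] by (simp add: mult_neg_pos)
  qed
  moreover have "R y < 0" if "y \<noteq> 0"
    using insert.IH[OF _ xy(2)[unfolded W_def] that] insert.prems(1) by (simp add: R_def)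
  moreover have "R 0 = 0"
    by (simp only: R_def T_zero cip_zero_left) simp
  moreover have "x \<noteq> 0 \<or> y \<noteq> 0"
    using insert.prems(3) xy(3) by auto
  ultimately have "R \<phi> < 0"
    by (cases "x = 0"; cases "y = 0") auto
  then show ?case by (simp add: R_def)
qed

end

section \<open>The magnetic Laplacian\<close>

locale magnetic_graph = pair_graph G for G :: "'v pair_pre_digraph" +
  fixes \<alpha> :: "'v \<times> 'v \<Rightarrow> real"
  assumes potential: "magnetic_potential G \<alpha>"
begin

text \<open>The discrete gradient twisted by the potential: the value at the end of the arc is
  transported to its start by the phase before subtracting.\<close>

definition magnetic_diff :: "('v \<Rightarrow> complex) \<Rightarrow> 'v \<times> 'v \<Rightarrow> complex" where
  "magnetic_diff \<phi> e = \<phi> (fst e) - cis (\<alpha> e) * \<phi> (snd e)"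

lemma cis_swap:
  assumes "e \<in> parcs G"
  shows "cis (\<alpha> (prod.swap e)) = cnj (cis (\<alpha> e))"
proof -
  obtain n :: int where "- \<alpha> e = \<alpha> (prod.swap e) + of_int n * (2 * pi)"
    using potential assms by (auto simp: magnetic_potential_def rcong_altdef)
  then have "cis (- \<alpha> e) = cis (\<alpha> (prod.swap e)) * cis (2 * pi * of_int n)"
    by (simp add: cis_mult mult_ac)
  then show ?thesis by (simp add: cis_cnj)
qed

lemma cis_mult_cnj: "cis a * cnj (cis a) = 1"
  by (simp add: cis_cnj cis_mult)

text \<open>The phase has modulus one and can be pulled out of the reversed difference, so both arcs
  of an edge carry the same energy.\<close>

lemma magnetic_diff_swap:
  assumes "e \<in> parcs G"
  shows "magnetic_diff \<phi> (prod.swap e) = - cnj (cis (\<alpha> e)) * magnetic_diff \<phi> e"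
proof -
  have "cnj (cis (\<alpha> e)) * (cis (\<alpha> e) * \<phi> (snd e)) = \<phi> (snd e)"
    using cis_mult_cnj[of "\<alpha> e"] by (metis mult.assoc mult.commute mult_1)
  then show ?thesis
    by (simp add: magnetic_diff_def cis_swap[OF assms] right_diff_distrib)
qed

lemma magnetic_laplacian_eq_sum:
  assumes "v \<in> pverts G"
  shows "magnetic_laplacian G \<alpha> \<phi> v = (\<Sum>e\<in>{e \<in> parcs G. fst e = v}. magnetic_diff \<phi> e)"
proof -
  have "(\<Sum>e\<in>{e \<in> parcs G. fst e = v}. magnetic_diff \<phi> e) =
      (\<Sum>e\<in>{e \<in> parcs G. fst e = v}. \<phi> v - cis (\<alpha> e) * \<phi> (snd e))"
    by (rule sum.cong) (auto simp: magnetic_diff_def)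
  then show ?thesis
    using assms by (simp add: magnetic_laplacian_def Digraph.out_degree_def Digraph.out_arcs_def
        sum_subtractf)
qed

text \<open>Summation by parts: the left side is a sum over arcs, grouped by initial vertex. A
  second copy, taken over reversed arcs, supplies the other half of the conjugated gradient of
  \<psi>; hence the factor 2.\<close>

lemma dirichlet_form:
  "2 * cip (pverts G) (magnetic_laplacian G \<alpha> \<phi>) \<psi> =
     (\<Sum>e\<in>parcs G. magnetic_diff \<phi> e * cnj (magnetic_diff \<psi> e))"
proof -
  let ?c = "cip (pverts G) (magnetic_laplacian G \<alpha> \<phi>) \<psi>"
  have "?c = (\<Sum>v\<in>pverts G. \<Sum>e\<in>{e \<in> parcs G. fst e = v}. magnetic_diff \<phi> e * cnj (\<psi> (fst e)))"
    unfolding cip_def by (rule sum.cong) (auto simp: magnetic_laplacian_eq_sum sum_distrib_right)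
  also have "\<dots> = (\<Sum>e\<in>parcs G. magnetic_diff \<phi> e * cnj (\<psi> (fst e)))"
    using pair_finite_arcs pair_finite_verts arc_fst_in_verts by (intro sum.group) blast+
  finally have 1: "?c = (\<Sum>e\<in>parcs G. magnetic_diff \<phi> e * cnj (\<psi> (fst e)))" .
  also have "\<dots> = (\<Sum>e\<in>parcs G. magnetic_diff \<phi> (prod.swap e) * cnj (\<psi> (snd e)))"
    by (rule sum.reindex_bij_witness[of _ prod.swap prod.swap]) (auto intro: arcs_symmetric)
  also have "\<dots> = (\<Sum>e\<in>parcs G. magnetic_diff \<phi> e * - cnj (cis (\<alpha> e) * \<psi> (snd e)))"
    by (rule sum.cong) (auto simp: magnetic_diff_swap simp del: swap_simp)
  finally have "2 * ?c = (\<Sum>e\<in>parcs G. magnetic_diff \<phi> e * cnj (\<psi> (fst e))) +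
      (\<Sum>e\<in>parcs G. magnetic_diff \<phi> e * - cnj (cis (\<alpha> e) * \<psi> (snd e)))"
    using 1 by simp
  also have "\<dots> = (\<Sum>e\<in>parcs G. magnetic_diff \<phi> e * cnj (magnetic_diff \<psi> e))"
    unfolding sum.distrib[symmetric]
    by (rule sum.cong) (auto simp: magnetic_diff_def[of \<psi>] right_diff_distrib)
  finally show ?thesis .
qed

sublocale hermitian_operator "pverts G" "magnetic_laplacian G \<alpha>"
proof
  show "finite (pverts G)" by (rule pair_finite_verts)
  show "magnetic_laplacian G \<alpha> (\<phi> + \<psi>) =
      magnetic_laplacian G \<alpha> \<phi> + magnetic_laplacian G \<alpha> \<psi>" for \<phi> \<psi>
    by (rule ext) (simp add: magnetic_laplacian_def distrib_left sum.distrib)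
  show "magnetic_laplacian G \<alpha> (\<lambda>v. c * \<phi> v) = (\<lambda>v. c * magnetic_laplacian G \<alpha> \<phi> v)" for c \<phi>
    by (rule ext) (simp add: magnetic_laplacian_def right_diff_distrib sum_distrib_left mult_ac)
  show "magnetic_laplacian G \<alpha> \<phi> \<in> supp_functions (pverts G)" for \<phi>
    by (simp add: supp_functions_def magnetic_laplacian_def)
  fix \<phi> \<psi>
  \<comment> \<open>Self-adjointness: the arc sum in \<open>dirichlet_form\<close> becomes its
    conjugate when \<phi> and \<psi> are exchanged.\<close>
  have "2 * cip (pverts G) \<phi> (magnetic_laplacian G \<alpha> \<psi>) =
      cnj (2 * cip (pverts G) (magnetic_laplacian G \<alpha> \<psi>) \<phi>)"
    using cip_commute[of "pverts G" \<phi>] by simp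
  also have "\<dots> = 2 * cip (pverts G) (magnetic_laplacian G \<alpha> \<phi>) \<psi>"
    unfolding dirichlet_form cnj_sum by (rule sum.cong) simp_all
  finally show "cip (pverts G) (magnetic_laplacian G \<alpha> \<phi>) \<psi> =
      cip (pverts G) \<phi> (magnetic_laplacian G \<alpha> \<psi>)" by simp
qed

section \<open>The list of eigenvalues and the dimensions of sums of eigenspaces\<close>

lemma eigenspace_eq: "eigenspace G \<alpha> \<mu> = eigsp (of_real \<mu>)"
  by (simp add: eigenspace_def eigsp_def vertex_functions_def supp_functions_def)

lemma span_eigenspaces:
  "cfun.span (\<Union>\<mu>\<in>eigenvalues G \<alpha>. eigsp (of_real \<mu>)) = supp_functions (pverts G)"
proof -
  have "\<phi> \<in> cfun.span (\<Union>\<mu>\<in>eigenvalues G \<alpha>. eigsp (of_real \<mu>))" if "\<phi> \<in> eigsp z" for z \<phi>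
  proof (cases "\<phi> = 0")
    case True
    show ?thesis unfolding True by (rule cfun.span_zero)
  next
    case False
    with that have "z \<in> \<real>" by (rule eigsp_real)
    then obtain \<mu> where "z = of_real \<mu>" by (rule Reals_cases)
    with that False have "\<mu> \<in> eigenvalues G \<alpha>" "\<phi> \<in> eigsp (of_real \<mu>)"
      by (auto simp: eigenvalues_def eigenspace_eq)
    then show ?thesis by (blast intro: cfun.span_base)
  qed
  then have "cfun.span (\<Union>z. eigsp z) \<subseteq> cfun.span (\<Union>\<mu>\<in>eigenvalues G \<alpha>. eigsp (of_real \<mu>))"
    by (intro cfun.span_minimal cfun.subspace_span) blast
  moreover have "cfun.span (\<Union>\<mu>\<in>eigenvalues G \<alpha>. eigsp (of_real \<mu>)) \<subseteq> cfun.span (\<Union>z. eigsp z)"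
    by (rule cfun.span_mono) blast
  ultimately show ?thesis by (simp add: span_eigsp)
qed

text \<open>Bases are fixed for all real \<mu> at once, empty where \<mu> is no eigenvalue. Counting
  list entries then becomes counting elements of unions of the sets \<open>B \<mu>\<close>.\<close>

lemma eigenbasis:
  obtains B where "\<And>\<mu>. cfun.independent (B \<mu>)" "\<And>\<mu>. cfun.span (B \<mu>) = eigsp (of_real \<mu>)"
    "\<And>\<mu>. card (B \<mu>) = eigen_multiplicity G \<alpha> \<mu>"
proof -
  have "\<exists>B. cfun.independent B \<and> cfun.span B = eigsp (of_real \<mu>) \<and>
      card B = eigen_multiplicity G \<alpha> \<mu>" for \<mu>
    using cfun.basis_exists[of "eigsp (of_real \<mu>)"]
      cfun.span_subspace[OF _ _ subspace_eigsp] unfolding eigen_multiplicity_def eigenspace_eq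
    by metis
  then show thesis using that by metis
qed

context
  fixes B :: "real \<Rightarrow> ('v \<Rightarrow> complex) set"
  assumes independent_B: "cfun.independent (B \<mu>)"
    and span_B: "cfun.span (B \<mu>) = eigsp (of_real \<mu>)"
    and card_B: "card (B \<mu>) = eigen_multiplicity G \<alpha> \<mu>"
begin

lemma span_UN_B: "cfun.span (\<Union>\<mu>\<in>F. B \<mu>) = cfun.span (\<Union>\<mu>\<in>F. eigsp (of_real \<mu>))"
proof
  have "B \<mu> \<subseteq> eigsp (of_real \<mu>)" for \<mu>
    using cfun.span_superset[of "B \<mu>"] by (simp add: span_B)
  then show "cfun.span (\<Union>\<mu>\<in>F. B \<mu>) \<subseteq> cfun.span (\<Union>\<mu>\<in>F. eigsp (of_real \<mu>))"
    by (intro cfun.span_mono) blast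
  have "eigsp (of_real \<mu>) \<subseteq> cfun.span (\<Union>\<mu>\<in>F. B \<mu>)" if "\<mu> \<in> F" for \<mu>
    unfolding span_B[symmetric] using that by (intro cfun.span_mono) blast
  then show "cfun.span (\<Union>\<mu>\<in>F. eigsp (of_real \<mu>)) \<subseteq> cfun.span (\<Union>\<mu>\<in>F. B \<mu>)"
    by (intro cfun.span_minimal cfun.subspace_span) blast
qed

text \<open>A common vector is orthogonal to itself.\<close>

lemma span_B_inter:
  assumes "\<mu> \<notin> F"
  shows "cfun.span (B \<mu>) \<inter> cfun.span (\<Union>\<nu>\<in>F. B \<nu>) \<subseteq> {0}"
proof
  fix \<phi> assume \<phi>: "\<phi> \<in> cfun.span (B \<mu>) \<inter> cfun.span (\<Union>\<nu>\<in>F. B \<nu>)"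
  have "cip (pverts G) \<phi> \<phi> = 0"
  proof (rule span_eigsp_orthogonal)
    show "\<phi> \<in> cfun.span (\<Union>z\<in>{of_real \<mu>}. eigsp z)"
      using \<phi> by (auto simp: span_B intro: cfun.span_base)
    show "\<phi> \<in> cfun.span (\<Union>z\<in>of_real ` F. eigsp z)"
      using \<phi> by (simp add: span_UN_B image_image)
    show "{complex_of_real \<mu>} \<inter> of_real ` F = {}"
      using assms by auto
  qed
  moreover have "\<phi> \<in> supp_functions (pverts G)"
    using \<phi> by (simp add: span_B eigsp_def)
  ultimately have "\<phi> = 0"
    by (intro cip_self_eq_0[OF finite_V])
  then show "\<phi> \<in> {0}" by blast
qed

lemma disjoint_B:
  assumes "\<mu> \<noteq> \<nu>"
  shows "B \<mu> \<inter> B \<nu> = {}"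
proof -
  have "cfun.span (B \<mu>) \<inter> cfun.span (B \<nu>) \<subseteq> {0}"
    using span_B_inter[of \<mu> "{\<nu>}"] assms by simp
  then show ?thesis
    by (rule cfun.disjoint_if_span_inter[OF independent_B])
qed

lemma independent_UN_B: "cfun.independent (\<Union>\<mu>\<in>F. B \<mu>)"
  by (intro cfun.independent_UN independent_B span_B_inter) blast

lemma finite_UN_B: "finite (\<Union>\<mu>\<in>F. B \<mu>)"
proof (rule independent_supp_functions(1)[OF finite_V independent_UN_B])
  show "(\<Union>\<mu>\<in>F. B \<mu>) \<subseteq> supp_functions (pverts G)"
    using cfun.span_superset[of "B _"] by (auto simp: span_B eigsp_def)
qed

text \<open>The bases at eigenvalues are nonempty and pairwise disjoint, and their union is finite
  as an independent set in a finite-dimensional space.\<close>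

lemma finite_eigenvalues: "finite (eigenvalues G \<alpha>)"
proof -
  have "B \<mu> \<noteq> {}" if "\<mu> \<in> eigenvalues G \<alpha>" for \<mu>
  proof
    assume "B \<mu> = {}"
    then have "eigsp (of_real \<mu>) = {0}" using span_B[of \<mu>] by simp
    with that show False by (auto simp: eigenvalues_def eigenspace_eq)
  qed
  then have "inj_on B (eigenvalues G \<alpha>)"
    using disjoint_B by (metis inf.idem inj_onI)
  moreover have "finite (B ` eigenvalues G \<alpha>)"
    by (rule finite_UnionD) (rule finite_UN_B)
  ultimately show ?thesis by (simp add: finite_image_iff)
qed

lemma sum_multiplicities:
  assumes "F \<subseteq> eigenvalues G \<alpha>"
  shows "(\<Sum>\<mu>\<in>F. eigen_multiplicity G \<alpha> \<mu>) = card (\<Union>\<mu>\<in>F. B \<mu>)"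
proof -
  have "finite (B \<mu>)" for \<mu>
    using finite_UN_B[of "{\<mu>}"] by simp
  then show ?thesis
    using finite_subset[OF assms finite_eigenvalues] disjoint_B
    by (subst card_UN_disjoint) (auto simp: card_B)
qed

text \<open>By the spectral theorem the chosen eigenvectors form a basis of the whole space. This
  guarantees that \<open>eigval\<close> reads an actual list entry for \<open>k\<close> from 1 to
  the number of vertices.\<close>

lemma length_eigenvalue_list: "length (eigenvalue_list G \<alpha>) = card (pverts G)"
proof -
  have "length (eigenvalue_list G \<alpha>) = (\<Sum>\<mu>\<in>eigenvalues G \<alpha>. eigen_multiplicity G \<alpha> \<mu>)"
    unfolding eigenvalue_list_def length_concat_replicate
    by (simp add: sum_list_distinct_conv_sum_set finite_eigenvalues)
  also have "\<dots> = card (pverts G)"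
    unfolding sum_multiplicities[OF order_refl]
    by (rule card_eq_if_spans_supp_functions[OF finite_V independent_UN_B])
      (simp add: span_UN_B span_eigenspaces)
  finally show ?thesis .
qed

lemma length_filter_eigenvalue_list:
  "length (filter P (eigenvalue_list G \<alpha>)) = card (\<Union>\<mu>\<in>{\<mu> \<in> eigenvalues G \<alpha>. P \<mu>}. B \<mu>)"
proof -
  have "length (filter P (eigenvalue_list G \<alpha>)) =
      (\<Sum>\<mu>\<in>{\<mu> \<in> eigenvalues G \<alpha>. P \<mu>}. eigen_multiplicity G \<alpha> \<mu>)"
    unfolding eigenvalue_list_def filter_concat_replicate length_concat_replicate
    by (simp add: sum_list_distinct_conv_sum_set finite_eigenvalues)
  then show ?thesis by (subst (asm) sum_multiplicities) auto
qed

end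

text \<open>One half of the Courant-Fischer principle; the subspace is spanned by the eigenvectors
  with eigenvalue below \<open>c\<close>.\<close>

lemma eigval_less_imp_subspace:
  assumes "1 \<le> k" "k \<le> card (pverts G)" "eigval G \<alpha> k < c"
  obtains B where "cfun.independent B" "B \<subseteq> supp_functions (pverts G)" "k \<le> card B"
    and "\<And>\<phi>. \<phi> \<in> cfun.span B \<Longrightarrow> \<phi> \<noteq> 0 \<Longrightarrow>
      Re (cip (pverts G) (magnetic_laplacian G \<alpha> \<phi>) \<phi>) < c * Re (cip (pverts G) \<phi> \<phi>)"
proof -
  obtain B where B: "\<And>\<mu>. cfun.independent (B \<mu>)" "\<And>\<mu>. cfun.span (B \<mu>) = eigsp (of_real \<mu>)"
    "\<And>\<mu>. card (B \<mu>) = eigen_multiplicity G \<alpha> \<mu>"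
    using eigenbasis by blast
  define F where "F = {\<mu> \<in> eigenvalues G \<alpha>. \<mu> < c}"
  show thesis
  proof (rule that[of "\<Union>\<mu>\<in>F. B \<mu>"])
    show "cfun.independent (\<Union>\<mu>\<in>F. B \<mu>)"
      by (rule independent_UN_B[OF B])
    show "(\<Union>\<mu>\<in>F. B \<mu>) \<subseteq> supp_functions (pverts G)"
      using cfun.span_superset[of "B _"] by (auto simp: B(2) eigsp_def)
    \<comment> \<open>The \<open>k\<close>-th eigenvalue sits at position \<open>k - 1\<close>, so
      the strict bound gives at least \<open>k\<close> small entries.\<close>
    have "k - 1 < length (filter (\<lambda>\<mu>. \<mu> < c) (eigenvalue_list G \<alpha>))"
    proof (rule length_filter_less_if_sorted)
      show "sorted (eigenvalue_list G \<alpha>)"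
        unfolding eigenvalue_list_def
        by (rule sorted_concat_replicate) (rule sorted_sorted_list_of_set)
      show "k - 1 < length (eigenvalue_list G \<alpha>)"
        using assms(1,2) by (simp add: length_eigenvalue_list[OF B])
      show "eigenvalue_list G \<alpha> ! (k - 1) < c"
        using assms(3) by (simp add: eigval_def)
    qed
    then show "k \<le> card (\<Union>\<mu>\<in>F. B \<mu>)"
      unfolding length_filter_eigenvalue_list[OF B] F_def by simp
    fix \<phi> :: "'v \<Rightarrow> complex" assume "\<phi> \<in> cfun.span (\<Union>\<mu>\<in>F. B \<mu>)" "\<phi> \<noteq> 0"
    then show "Re (cip (pverts G) (magnetic_laplacian G \<alpha> \<phi>) \<phi>) < c * Re (cip (pverts G) \<phi> \<phi>)"
      unfolding span_UN_B[OF B] using finite_eigenvalues[OF B]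
      by (intro rayleigh_less[of F]) (auto simp: F_def)
  qed
qed

section \<open>Test functions from a perfect matching\<close>

text \<open>Functions for which every arc of the matching attains the maximal Dirichlet energy.\<close>

definition alternating :: "'v set set \<Rightarrow> ('v \<Rightarrow> complex) set" where
  "alternating M = {\<phi> \<in> supp_functions (pverts G).
     \<forall>u v. (u, v) \<in> parcs G \<longrightarrow> {u, v} \<in> M \<longrightarrow> \<phi> u = - cis (\<alpha> (u, v)) * \<phi> v}"

lemma subspace_alternating: "cfun.subspace (alternating M)"
  unfolding cfun.subspace_def alternating_def supp_functions_def
  by (auto simp: distrib_left mult.left_commute)

lemma edge_arc:
  assumes "{u, v} \<in> edges G"
  shows "(u, v) \<in> parcs G"
  using assms arcs_symmetric by (auto simp: edges_def doubleton_eq_iff)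

text \<open>The arc from \<open>v\<close> to its partner has difference \<open>2 * \<phi> v\<close>,
  hence energy four times the squared modulus of \<open>\<phi> v\<close>. The other arcs contribute
  nonnegatively, and \<open>dirichlet_form\<close> halves the total.\<close>

lemma alternating_rayleigh:
  assumes "perfect_matching G M" "\<phi> \<in> alternating M"
  shows "2 * Re (cip (pverts G) \<phi> \<phi>) \<le> Re (cip (pverts G) (magnetic_laplacian G \<alpha> \<phi>) \<phi>)"
proof -
  have M: "M \<subseteq> edges G" "\<forall>v\<in>pverts G. \<exists>e\<in>M. v \<in> e"
    using assms(1) unfolding perfect_matching_def matching_def by blast+
  have "\<exists>w. (v, w) \<in> parcs G \<and> {v, w} \<in> M" if v: "v \<in> pverts G" for v
  proof -
    from M v obtain e where e: "e \<in> M" "v \<in> e" "e \<in> edges G" by blast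
    then obtain a b where "e = {a, b}" unfolding edges_def by blast
    with e have ab: "{a, b} \<in> M" "{a, b} \<in> edges G" "v \<in> {a, b}" by simp_all
    from ab(3) obtain w where "{v, w} = {a, b}" by blast
    with ab(1,2) have "{v, w} \<in> M" "{v, w} \<in> edges G" by simp_all
    then show ?thesis using edge_arc by blast
  qed
  then obtain p where p: "\<And>v. v \<in> pverts G \<Longrightarrow> (v, p v) \<in> parcs G \<and> {v, p v} \<in> M"
    by metis
  have diff: "magnetic_diff \<phi> (v, p v) = 2 * \<phi> v" if "v \<in> pverts G" for v
  proof -
    have "\<phi> v = - cis (\<alpha> (v, p v)) * \<phi> (p v)"
      using p[OF that] assms(2) unfolding alternating_def by blast
    then have "- (cis (\<alpha> (v, p v)) * \<phi> (p v)) = \<phi> v"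
      unfolding mult_minus_left by (rule sym)
    then show ?thesis by (simp add: magnetic_diff_def flip: add_uminus_conv_diff)
  qed
  have "4 * Re (cip (pverts G) \<phi> \<phi>) = (\<Sum>v\<in>pverts G. (cmod (magnetic_diff \<phi> (v, p v)))\<^sup>2)"
    by (simp add: cip_self diff norm_mult power_mult_distrib sum_distrib_left
        del: of_real_sum of_real_power)
  \<comment> \<open>The arcs \<open>(v, p v)\<close> have distinct initial vertices, so none is
    counted twice; each matching edge occurs in both directions.\<close>
  also have "\<dots> = (\<Sum>e\<in>(\<lambda>v. (v, p v)) ` pverts G. (cmod (magnetic_diff \<phi> e))\<^sup>2)"
    by (subst sum.reindex) (auto simp: inj_on_def)
  also have "\<dots> \<le> (\<Sum>e\<in>parcs G. (cmod (magnetic_diff \<phi> e))\<^sup>2)"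
    using p by (intro sum_mono2 pair_finite_arcs) auto
  also have "\<dots> = Re (2 * cip (pverts G) (magnetic_laplacian G \<alpha> \<phi>) \<phi>)"
    unfolding dirichlet_form complex_norm_square[symmetric] Re_sum Re_complex_of_real ..
  finally show ?thesis by simp
qed

text \<open>The matching partitions the vertices into blocks of size two, as there are no
  loops.\<close>

lemma card_perfect_matching:
  assumes "perfect_matching G M"
  shows "2 * card M = card (pverts G)"
proof -
  have M: "M \<subseteq> edges G" "\<forall>e\<in>M. \<forall>f\<in>M. e \<noteq> f \<longrightarrow> e \<inter> f = {}" "\<forall>v\<in>pverts G. \<exists>e\<in>M. v \<in> e"
    using assms unfolding perfect_matching_def matching_def by blast+
  have "\<Union>M = pverts G"
  proof
    have "e \<subseteq> pverts G" if "e \<in> edges G" for e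
      using that in_arcsD1 in_arcsD2 by (auto simp: edges_def)
    with M(1) show "\<Union>M \<subseteq> pverts G" by blast
    show "pverts G \<subseteq> \<Union>M" using M(3) by blast
  qed
  moreover have "card e = 2" if e: "e \<in> M" for e
  proof -
    obtain u v where "e = {u, v}" "(u, v) \<in> parcs G"
      using e M(1) unfolding edges_def by blast
    then show ?thesis using no_loops'[of u v] by simp
  qed
  moreover have "finite (\<Union>M)"
    using calculation(1) pair_finite_verts by simp
  ultimately show ?thesis
    using card_partition[of M 2] M(2) finite_UnionD[of M] by simp
qed

text \<open>Each matching edge supports an alternating function of its own, and disjointness of the
  edges makes these functions independent.\<close>

lemma alternating_independent:
  assumes "perfect_matching G M"
  obtains C where "cfun.independent C" "C \<subseteq> alternating M" "card C = card M"
proof -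
  have M: "M \<subseteq> edges G" "\<And>e f. e \<in> M \<Longrightarrow> f \<in> M \<Longrightarrow> e \<noteq> f \<Longrightarrow> e \<inter> f = {}"
    using assms unfolding perfect_matching_def matching_def by blast+
  have "\<exists>a b. (a, b) \<in> parcs G \<and> e = {a, b}" if "e \<in> M" for e
    using M(1) that unfolding edges_def by blast
  then obtain a b where ab: "\<And>e. e \<in> M \<Longrightarrow> (a e, b e) \<in> parcs G" "\<And>e. e \<in> M \<Longrightarrow> e = {a e, b e}"
    by metis
  \<comment> \<open>The value at \<open>b e\<close> is normalised to 1; the alternating condition
    then forces the value at \<open>a e\<close>.\<close>
  define w where "w e = (\<lambda>v. if v = a e then - cis (\<alpha> (a e, b e)) else if v = b e then 1 else 0)"
    for e
  have w_b: "w e (b e) = 1" if "e \<in> M" for e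
    using no_loops'[OF ab(1)[OF that]] by (auto simp: w_def)
  have w_out: "w e v = 0" if "e \<in> M" "v \<notin> e" for e v
    using ab(2)[OF that(1)] that(2) by (auto simp: w_def)
  have w_other: "w e (b f) = 0" if "e \<in> M" "f \<in> M" "e \<noteq> f" for e f
    using M(2)[OF that] ab(2)[OF that(2)] w_out[OF that(1)] by blast
  have inj: "inj_on w M"
    by (rule inj_onI) (metis w_b w_other zero_neq_one)
  have alternating: "w e \<in> alternating M" if e: "e \<in> M" for e
  proof -
    have "w e u = - cis (\<alpha> (u, v)) * w e v" if uv: "(u, v) \<in> parcs G" "{u, v} \<in> M" for u v
    proof (cases "{u, v} = e")
      case True
      then consider "u = a e" "v = b e" | "u = b e" "v = a e"
        using ab(2)[OF e] by (metis doubleton_eq_iff)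
      then show ?thesis
      proof cases
        case 1
        then show ?thesis using w_b[OF e] by (simp add: w_def)
      next
        case 2
        have "cis (\<alpha> (b e, a e)) = cnj (cis (\<alpha> (a e, b e)))"
          using cis_swap[OF ab(1)[OF e]] by simp
        then show ?thesis
          using 2 w_b[OF e] cis_mult_cnj[of "\<alpha> (a e, b e)"] by (simp add: w_def mult.commute)
      qed
    next
      case False
      then have "{u, v} \<inter> e = {}" using M(2) uv(2) e by blast
      then show ?thesis using w_out[OF e] by simp
    qed
    moreover have "w e \<in> supp_functions (pverts G)"
      using ab(1)[OF e] in_arcsD1 in_arcsD2 by (auto simp: supp_functions_def w_def)
    ultimately show ?thesis by (auto simp: alternating_def)
  qed
  have "cfun.independent (\<Union>e\<in>M. {w e})"
  proof (rule cfun.independent_UN)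
    fix e assume e: "e \<in> M"
    have "w e \<noteq> 0" using w_b[OF e] by auto
    then show "cfun.independent {w e}" by (simp add: cfun.dependent_single)
    \<comment> \<open>Evaluation at \<open>b e\<close> is 1 on \<open>w e\<close> and kills all
      other \<open>w f\<close>, which separates the spans.\<close>
    let ?S = "{\<phi>. \<phi> (b e) = (0 :: complex)}"
    have "cfun.span (\<Union>f\<in>M - {e}. {w f}) \<subseteq> ?S"
      by (rule cfun.span_minimal) (use w_other e in \<open>auto simp: cfun.subspace_def\<close>)
    then show "cfun.span {w e} \<inter> cfun.span (\<Union>f\<in>M - {e}. {w f}) \<subseteq> {0}"
      using w_b[OF e] by (auto simp: cfun.span_singleton fun_eq_iff)
  qed
  then have "cfun.independent (w ` M)"
    by (simp add: UNION_singleton_eq_range)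
  then show thesis
    using that[of "w ` M"] alternating inj by (auto simp: card_image)
qed

text \<open>Otherwise there are independent sets of at least \<open>k\<close> and of exactly
  \<open>card M\<close> elements whose spans meet only in zero, too many for a space of dimension
  \<open>2 * card M\<close>.\<close>

lemma eigval_ge_2_if_perfect_matching:
  assumes "perfect_matching G M" "card M < k" "k \<le> card (pverts G)"
  shows "2 \<le> eigval G \<alpha> k"
proof (rule ccontr)
  assume "\<not> 2 \<le> eigval G \<alpha> k"
  then obtain B where B: "cfun.independent B" "B \<subseteq> supp_functions (pverts G)" "k \<le> card B"
    and less: "\<And>\<phi>. \<phi> \<in> cfun.span B \<Longrightarrow> \<phi> \<noteq> 0 \<Longrightarrow>
      Re (cip (pverts G) (magnetic_laplacian G \<alpha> \<phi>) \<phi>) < 2 * Re (cip (pverts G) \<phi> \<phi>)"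
    using assms(2,3) eigval_less_imp_subspace[of k 2] by auto
  obtain C where C: "cfun.independent C" "C \<subseteq> alternating M" "card C = card M"
    using alternating_independent[OF assms(1)] by blast
  have "cfun.span C \<subseteq> alternating M"
    by (rule cfun.span_minimal[OF C(2) subspace_alternating])
  \<comment> \<open>On a nonzero common vector the strict upper bound from \<open>less\<close> would
    contradict the lower bound for alternating functions.\<close>
  then have disj: "cfun.span B \<inter> cfun.span C \<subseteq> {0}"
    using less alternating_rayleigh[OF assms(1)] by (auto simp: not_less[symmetric])
  have C': "C \<subseteq> supp_functions (pverts G)"
    using C(2) by (auto simp: alternating_def)
  have "card (B \<union> C) \<le> card (pverts G)"
    using independent_supp_functions(2)[OF finite_V cfun.independent_Un[OF B(1) C(1) disj]] B(2) C'
    by blast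
  moreover have "card (B \<union> C) = card B + card C"
    using independent_supp_functions(1)[OF finite_V] B C C' cfun.disjoint_if_span_inter[OF B(1) disj]
    by (intro card_Un_disjoint) auto
  ultimately show False
    using B(3) C(3) assms(2) card_perfect_matching[OF assms(1)] by linarith
qed

end

theorem corollary3p6:
  fixes G :: "'v pair_pre_digraph"
  assumes "pair_graph G"
    and "pverts G \<noteq> {}"
    and "even (card (pverts G))"
    and "\<exists>\<alpha>. magnetic_potential G \<alpha> \<and> eigval G \<alpha> (card (pverts G) div 2 + 1) < 2"
  shows "\<not> matchable G"
proof
  assume "matchable G"
  then obtain M where M: "perfect_matching G M" by (auto simp: matchable_def)
  from assms(4) obtain \<alpha> where \<alpha>: "magnetic_potential G \<alpha>"
    "eigval G \<alpha> (card (pverts G) div 2 + 1) < 2" by blast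
  interpret magnetic_graph G \<alpha>
    using assms(1) \<alpha>(1) by (simp add: magnetic_graph_def magnetic_graph_axioms_def)
  \<comment> \<open>Without vertices the index would point past the end of an empty list. A positive
    number \<open>2 * card M\<close> of vertices is at least \<open>card M + 1\<close>, so the index
    is in range.\<close>
  have "card (pverts G) > 0"
    using assms(2) pair_finite_verts by (simp add: card_gt_0_iff)
  with card_perfect_matching[OF M] have "card M < card (pverts G) div 2 + 1"
    "card (pverts G) div 2 + 1 \<le> card (pverts G)" by linarith+
  from eigval_ge_2_if_perfect_matching[OF M this] \<alpha>(2) show False by simp
qed

end
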